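(* Let $P$ be a submonoid of a group and let $\mathrm C^*_{\#}(P)$ be the universal $\mathrm C^*$-algebra generated by a family of elements $\{w_p:p\in P\}$ subject to the relations (T1) $w_e=1$; (T2) $\dot w_\alpha=0$ if $K(\alpha)=\emptyset$ with $\alpha$ neutral; and (T3) $\dot w_\alpha=\dot w_\beta$ if $\alpha$ and $\beta$ are neutral words such that $K(\alpha)=K(\beta)$. Then $\mathrm C^*_{\#}(P)$ is canonically isomorphic to Li's semigroup $\mathrm C^*$-algebra $\mathrm C^*_s(P)$, i.e. there is an isomorphism that maps $w_p$ to $v_p$.
   Context: Let $P$ be a submonoid of a group $G$ with identity $e$. A word is a finite sequence $\alpha=(p_1,p_2,\ldots,p_{2k-1},p_{2k})$ of even length $2k\ge 0$ with entries in $P$; $\mathcal W$ is the set of all words (including the empty word). Put $\dot\alpha:=p_1^{-1}p_2\cdots p_{2k-1}^{-1}p_{2k}\in G$ (equal to $e$ for the empty word); $\alpha$ is neutral if $\dot\alpha=e$. Put $K(\alpha):=P\cap p_{2k}^{-1}p_{2k-1}P\cap p_{2k}^{-1}p_{2k-1}p_{2k-2}^{-1}p_{2k-3}P\cap\cdots\cap p_{2k}^{-1}p_{2k-1}\cdots p_2^{-1}p_1P\subseteq P$ (equal to $P$ for the empty word), and $\mathfrak J:=\{K(\alpha):\alpha\in\mathcal W\}$, the collection of constructible right ideals. For a family $\{w_p\}_{p\in P}$ in a unital $\mathrm C^*$-algebra, $\dot w_\alpha:=w_{p_1}^*w_{p_2}\cdots w_{p_{2k-1}}^*w_{p_{2k}}$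 ($=1$ for the empty word). $\mathrm C^*_s(P)$ is the universal $\mathrm C^*$-algebra generated by a family of isometries $\{v_p:p\in P\}$ and projections $\{e_S:S\in\mathfrak J\cup\{\emptyset\}\}$ such that (i) $v_pv_q=v_{pq}$ for $p,q\in P$; (ii) $e_\emptyset=0$; (iii) $\dot v_\alpha=e_S$ whenever $S\in\mathfrak J$ and $\alpha\in\mathcal W$ satisfy $\dot\alpha=e$ and $K(\alpha)=S$. *)

theory Defs
  imports Complex_Main "HOL-Algebra.Ring" "HOL-Algebra.Coset"
begin

definition words :: "'g set \<Rightarrow> 'g list set"
  where "words P = {\<alpha>. even (length \<alpha>) \<and> set \<alpha> \<subseteq> P}"

text \<open>Only lists of even length are words; the value on lists of odd length is irrelevant.\<close>

fun word_val :: "('g, 'm) monoid_scheme \<Rightarrow> 'g list \<Rightarrow> 'g"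
  where
    "word_val G [] = \<one>\<^bsub>G\<^esub>"
  | "word_val G [p] = \<one>\<^bsub>G\<^esub>"
  | "word_val G (p # q # \<alpha>) = inv\<^bsub>G\<^esub> p \<otimes>\<^bsub>G\<^esub> q \<otimes>\<^bsub>G\<^esub> word_val G \<alpha>"

definition neutral :: "('g, 'm) monoid_scheme \<Rightarrow> 'g list \<Rightarrow> bool"
  where "neutral G \<alpha> \<longleftrightarrow> word_val G \<alpha> = \<one>\<^bsub>G\<^esub>"

text \<open>
  For a word (p1, ..., p2k), dropping the first 2i letters and reversing leaves
  (p2k, p(2k-1), ..., p(2i+1)), so the i-th set in the intersection is
  p2k^{-1} p(2k-1) ... p(2i+2)^{-1} p(2i+1) P.
\<close>

definition K_ideal :: "('g, 'm) monoid_scheme \<Rightarrow> 'g set \<Rightarrow> 'g list \<Rightarrow> 'g set"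
  where "K_ideal G P \<alpha> =
    P \<inter> (\<Inter>i\<in>{..<length \<alpha> div 2}. word_val G (rev (drop (2 * i) \<alpha>)) <#\<^bsub>G\<^esub> P)"

definition constructible_ideals :: "('g, 'm) monoid_scheme \<Rightarrow> 'g set \<Rightarrow> 'g set set"
  where "constructible_ideals G P = K_ideal G P ` words P"

record 'a cstar = "'a ring" +
  cscale :: "complex \<Rightarrow> 'a \<Rightarrow> 'a"
  adj :: "'a \<Rightarrow> 'a"
  cnorm :: "'a \<Rightarrow> real"

locale unital_cstar_algebra = ring A for A :: "('a, 'm) cstar_scheme" (structure) +
  assumes scale_closed: "x \<in> carrier A \<Longrightarrow> cscale A c x \<in> carrier A"
    and scale_add_right: "\<lbrakk>x \<in> carrier A; y \<in> carrier A\<rbrakk> \<Longrightarrow>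
      cscale A c (x \<oplus> y) = cscale A c x \<oplus> cscale A c y"
    and scale_add_left: "x \<in> carrier A \<Longrightarrow>
      cscale A (c + d) x = cscale A c x \<oplus> cscale A d x"
    and scale_scale: "x \<in> carrier A \<Longrightarrow> cscale A c (cscale A d x) = cscale A (c * d) x"
    and scale_one: "x \<in> carrier A \<Longrightarrow> cscale A 1 x = x"
    and scale_mult_left: "\<lbrakk>x \<in> carrier A; y \<in> carrier A\<rbrakk> \<Longrightarrow>
      cscale A c x \<otimes> y = cscale A c (x \<otimes> y)"
    and scale_mult_right: "\<lbrakk>x \<in> carrier A; y \<in> carrier A\<rbrakk> \<Longrightarrow>
      x \<otimes> cscale A c y = cscale A c (x \<otimes> y)"
    and adj_closed: "x \<in> carrier A \<Longrightarrow> adj A x \<in> carrier A"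
    and adj_adj: "x \<in> carrier A \<Longrightarrow> adj A (adj A x) = x"
    and adj_add: "\<lbrakk>x \<in> carrier A; y \<in> carrier A\<rbrakk> \<Longrightarrow>
      adj A (x \<oplus> y) = adj A x \<oplus> adj A y"
    and adj_scale: "x \<in> carrier A \<Longrightarrow> adj A (cscale A c x) = cscale A (cnj c) (adj A x)"
    and adj_mult: "\<lbrakk>x \<in> carrier A; y \<in> carrier A\<rbrakk> \<Longrightarrow>
      adj A (x \<otimes> y) = adj A y \<otimes> adj A x"
    and norm_nonneg: "x \<in> carrier A \<Longrightarrow> 0 \<le> cnorm A x"
    and norm_eq_zero: "x \<in> carrier A \<Longrightarrow> cnorm A x = 0 \<longleftrightarrow> x = \<zero>"
    and norm_triangle: "\<lbrakk>x \<in> carrier A; y \<in> carrier A\<rbrakk> \<Longrightarrow>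
      cnorm A (x \<oplus> y) \<le> cnorm A x + cnorm A y"
    and norm_scale: "x \<in> carrier A \<Longrightarrow> cnorm A (cscale A c x) = cmod c * cnorm A x"
    and norm_mult: "\<lbrakk>x \<in> carrier A; y \<in> carrier A\<rbrakk> \<Longrightarrow>
      cnorm A (x \<otimes> y) \<le> cnorm A x * cnorm A y"
    and cstar_identity: "x \<in> carrier A \<Longrightarrow> cnorm A (adj A x \<otimes> x) = (cnorm A x)\<^sup>2"
    and norm_complete: "\<lbrakk>range \<sigma> \<subseteq> carrier A;
      \<forall>\<epsilon>>0. \<exists>N. \<forall>m\<ge>N. \<forall>n\<ge>N. cnorm A (\<sigma> m \<ominus> \<sigma> n) < \<epsilon>\<rbrakk> \<Longrightarrow>
      \<exists>x\<in>carrier A. (\<lambda>n. cnorm A (\<sigma> n \<ominus> x)) \<longlonglongrightarrow> 0"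

text \<open>
  Unital *-homomorphisms, as purely algebraic maps. They are automatically contractive,
  and bijective ones are automatically isometric.
\<close>

definition star_hom :: "('a, 'm) cstar_scheme \<Rightarrow> ('b, 'n) cstar_scheme \<Rightarrow> ('a \<Rightarrow> 'b) \<Rightarrow> bool"
  where "star_hom A B \<phi> \<longleftrightarrow> \<phi> \<in> ring_hom A B \<and>
    (\<forall>c. \<forall>x\<in>carrier A. \<phi> (cscale A c x) = cscale B c (\<phi> x)) \<and>
    (\<forall>x\<in>carrier A. \<phi> (adj A x) = adj B (\<phi> x))"

definition star_iso :: "('a, 'm) cstar_scheme \<Rightarrow> ('b, 'n) cstar_scheme \<Rightarrow> ('a \<Rightarrow> 'b) \<Rightarrow> bool"
  where "star_iso A B \<phi> \<longleftrightarrow> star_hom A B \<phi> \<and> bij_betw \<phi> (carrier A) (carrier B)"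

definition closed_star_subalgebra :: "('a, 'm) cstar_scheme \<Rightarrow> 'a set \<Rightarrow> bool"
  where "closed_star_subalgebra A D \<longleftrightarrow> D \<subseteq> carrier A \<and> \<one>\<^bsub>A\<^esub> \<in> D \<and>
    (\<forall>x\<in>D. \<forall>y\<in>D. x \<oplus>\<^bsub>A\<^esub> y \<in> D \<and> x \<otimes>\<^bsub>A\<^esub> y \<in> D) \<and>
    (\<forall>c. \<forall>x\<in>D. cscale A c x \<in> D) \<and> (\<forall>x\<in>D. adj A x \<in> D) \<and>
    (\<forall>\<sigma>. \<forall>x\<in>carrier A. range \<sigma> \<subseteq> D \<and> (\<lambda>n. cnorm A (\<sigma> n \<ominus>\<^bsub>A\<^esub> x)) \<longlonglongrightarrow> 0 \<longrightarrow> x \<in> D)"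

definition cstar_generated_by :: "('a, 'm) cstar_scheme \<Rightarrow> 'a set \<Rightarrow> bool"
  where "cstar_generated_by A X \<longleftrightarrow> X \<subseteq> carrier A \<and>
    (\<forall>D. closed_star_subalgebra A D \<and> X \<subseteq> D \<longrightarrow> D = carrier A)"

fun star_word :: "('a, 'm) cstar_scheme \<Rightarrow> ('g \<Rightarrow> 'a) \<Rightarrow> 'g list \<Rightarrow> 'a"
  where
    "star_word A w [] = \<one>\<^bsub>A\<^esub>"
  | "star_word A w [p] = \<one>\<^bsub>A\<^esub>"
  | "star_word A w (p # q # \<alpha>) = adj A (w p) \<otimes>\<^bsub>A\<^esub> w q \<otimes>\<^bsub>A\<^esub> star_word A w \<alpha>"

definition sharp_family ::
    "('g, 'm) monoid_scheme \<Rightarrow> 'g set \<Rightarrow> ('a, 'n) cstar_scheme \<Rightarrow> ('g \<Rightarrow> 'a) \<Rightarrow> bool"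
  where "sharp_family G P A w \<longleftrightarrow>
    (\<forall>p\<in>P. w p \<in> carrier A) \<and>
    w \<one>\<^bsub>G\<^esub> = \<one>\<^bsub>A\<^esub> \<and>
    (\<forall>\<alpha>\<in>words P. neutral G \<alpha> \<and> K_ideal G P \<alpha> = {} \<longrightarrow> star_word A w \<alpha> = \<zero>\<^bsub>A\<^esub>) \<and>
    (\<forall>\<alpha>\<in>words P. \<forall>\<beta>\<in>words P.
      neutral G \<alpha> \<and> neutral G \<beta> \<and> K_ideal G P \<alpha> = K_ideal G P \<beta> \<longrightarrow>
      star_word A w \<alpha> = star_word A w \<beta>)"

definition Li_family ::
    "('g, 'm) monoid_scheme \<Rightarrow> 'g set \<Rightarrow> ('a, 'n) cstar_scheme \<Rightarrow>
      ('g \<Rightarrow> 'a) \<Rightarrow> ('g set \<Rightarrow> 'a) \<Rightarrow> bool"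
  where "Li_family G P A v e \<longleftrightarrow>
    (\<forall>p\<in>P. v p \<in> carrier A \<and> adj A (v p) \<otimes>\<^bsub>A\<^esub> v p = \<one>\<^bsub>A\<^esub>) \<and>
    (\<forall>S\<in>constructible_ideals G P \<union> {{}}.
      e S \<in> carrier A \<and> adj A (e S) = e S \<and> e S \<otimes>\<^bsub>A\<^esub> e S = e S) \<and>
    (\<forall>p\<in>P. \<forall>q\<in>P. v p \<otimes>\<^bsub>A\<^esub> v q = v (p \<otimes>\<^bsub>G\<^esub> q)) \<and>
    e {} = \<zero>\<^bsub>A\<^esub> \<and>
    (\<forall>S\<in>constructible_ideals G P. \<forall>\<alpha>\<in>words P.
      neutral G \<alpha> \<and> K_ideal G P \<alpha> = S \<longrightarrow> star_word A v \<alpha> = e S)"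

text \<open>
  The universal property: the algebra is generated by the family, and every family in a unital
  C*-algebra satisfying the relations is the image of it under exactly one unital
  *-homomorphism. HOL cannot quantify over types inside a formula, so the element type 'c of
  the test algebras is a parameter. A universal C*-algebra in the usual sense has the property
  for every 'c; assuming it for particular types only is a weaker hypothesis.
\<close>

definition universal_sharp ::
    "('g, 'm) monoid_scheme \<Rightarrow> 'g set \<Rightarrow> 'a cstar \<Rightarrow> ('g \<Rightarrow> 'a) \<Rightarrow> 'c itself \<Rightarrow> bool"
  where "universal_sharp G P A w (T :: 'c itself) \<longleftrightarrow>
    unital_cstar_algebra A \<and> sharp_family G P A w \<and> cstar_generated_by A (w ` P) \<and>
    (\<forall>(B :: 'c cstar) u. unital_cstar_algebra B \<and> sharp_family G P B u \<longrightarrow>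
      (\<exists>\<phi>. star_hom A B \<phi> \<and> (\<forall>p\<in>P. \<phi> (w p) = u p) \<and>
        (\<forall>\<psi>. star_hom A B \<psi> \<and> (\<forall>p\<in>P. \<psi> (w p) = u p) \<longrightarrow> (\<forall>x\<in>carrier A. \<psi> x = \<phi> x))))"

definition universal_Li ::
    "('g, 'm) monoid_scheme \<Rightarrow> 'g set \<Rightarrow> 'a cstar \<Rightarrow> ('g \<Rightarrow> 'a) \<Rightarrow> ('g set \<Rightarrow> 'a) \<Rightarrow>
      'c itself \<Rightarrow> bool"
  where "universal_Li G P A v e (T :: 'c itself) \<longleftrightarrow>
    unital_cstar_algebra A \<and> Li_family G P A v e \<and>
    cstar_generated_by A (v ` P \<union> e ` (constructible_ideals G P \<union> {{}})) \<and>
    (\<forall>(B :: 'c cstar) u f. unital_cstar_algebra B \<and> Li_family G P B u f \<longrightarrow>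
      (\<exists>\<phi>. star_hom A B \<phi> \<and> (\<forall>p\<in>P. \<phi> (v p) = u p) \<and>
        (\<forall>S\<in>constructible_ideals G P \<union> {{}}. \<phi> (e S) = f S) \<and>
        (\<forall>\<psi>. star_hom A B \<psi> \<and> (\<forall>p\<in>P. \<psi> (v p) = u p) \<and>
            (\<forall>S\<in>constructible_ideals G P \<union> {{}}. \<psi> (e S) = f S) \<longrightarrow>
          (\<forall>x\<in>carrier A. \<psi> x = \<phi> x))))"

end

theory Submission
  imports Defs
begin

text \<open>
  A word acts on \<open>P\<close> as a partial left translation by \<open>word_val G \<alpha>\<close> with domain
  \<open>K_ideal G P \<alpha>\<close>, and the reversed word acts as the inverse partial translation. Hence
  every constructible ideal is the domain of the neutral word \<open>rev \<alpha> @ \<alpha>\<close>, and for neutral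
  \<open>\<alpha>\<close> the words \<open>\<alpha>\<close>, \<open>rev \<alpha>\<close> and \<open>\<alpha> @ \<alpha>\<close> have the same domain. By (T3) the elements
  \<open>star_word A w \<alpha>\<close> for neutral \<open>\<alpha>\<close> are therefore projections indexed by the ideals, and
  \<open>(p, p)\<close> shows that each \<open>w p\<close> is an isometry. Multiplicativity comes from the neutral word
  \<open>(pq, p, 1, q)\<close> with domain \<open>P\<close>: it gives \<open>y* x = 1\<close> for the isometries \<open>x = w p w q\<close> and
  \<open>y = w (pq)\<close>, so \<open>(x - y)* (x - y) = 0\<close> and \<open>x = y\<close> by the C*-identity. So the two universal
  algebras have the same representations.
\<close>

section \<open>Words and induction over pairs of letters\<close>

lemma words_Nil [simp]: "[] \<in> words P"
  by (simp add: words_def)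

lemma words_Cons2 [simp]: "p # q # \<alpha> \<in> words P \<longleftrightarrow> p \<in> P \<and> q \<in> P \<and> \<alpha> \<in> words P"
  by (auto simp: words_def)

lemma words_append: "\<alpha> \<in> words P \<Longrightarrow> \<beta> \<in> words P \<Longrightarrow> \<alpha> @ \<beta> \<in> words P"
  by (auto simp: words_def)

lemma words_rev: "\<alpha> \<in> words P \<Longrightarrow> rev \<alpha> \<in> words P"
  by (auto simp: words_def)

lemma words_drop: "\<alpha> \<in> words P \<Longrightarrow> drop (2 * i) \<alpha> \<in> words P"
  by (auto simp: words_def dest: in_set_dropD)

text \<open>Parity excludes the singleton case of two-step list induction, so the dummy equations of
  \<open>word_val\<close> and \<open>star_word\<close> never arise.\<close>

lemma words_induct [consumes 1, case_names Nil Cons]: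
  assumes "\<alpha> \<in> words P"
    and "Q []"
    and "\<And>p q \<alpha>. p \<in> P \<Longrightarrow> q \<in> P \<Longrightarrow> \<alpha> \<in> words P \<Longrightarrow> Q \<alpha> \<Longrightarrow> Q (p # q # \<alpha>)"
  shows "Q \<alpha>"
  using assms(1)
proof (induction \<alpha> rule: induct_list012)
  case (2 x)
  then show ?case by (simp add: words_def)
qed (use assms(2,3) in auto)

section \<open>Partial translations of the submonoid and their domains\<close>

locale group_submonoid = group G + submonoid P G
  for G :: "('g, 'm) monoid_scheme" (structure) and P :: "'g set"
begin

lemma in_carrier [simp]: "p \<in> P \<Longrightarrow> p \<in> carrier G"
  using subset by blast

lemma word_val_closed [simp]: "\<alpha> \<in> words P \<Longrightarrow> word_val G \<alpha> \<in> carrier G"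
  by (induction rule: words_induct) auto

lemma word_val_append:
  "\<alpha> \<in> words P \<Longrightarrow> \<beta> \<in> words P \<Longrightarrow> word_val G (\<alpha> @ \<beta>) = word_val G \<alpha> \<otimes> word_val G \<beta>"
  by (induction rule: words_induct) (auto simp: m_assoc)

lemma word_val_rev: "\<alpha> \<in> words P \<Longrightarrow> word_val G (rev \<alpha>) = inv (word_val G \<alpha>)"
  by (induction rule: words_induct) (simp_all add: word_val_append words_rev inv_mult_group m_assoc)

lemma l_coset_inv_iff:
  assumes "g \<in> carrier G" "x \<in> carrier G"
  shows "x \<in> inv g <# P \<longleftrightarrow> g \<otimes> x \<in> P"
proof
  assume "x \<in> inv g <# P"
  then obtain p where "p \<in> P" "x = inv g \<otimes> p"
    by (auto simp: l_coset_def)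
  with assms show "g \<otimes> x \<in> P"
    by (simp add: m_assoc [symmetric])
next
  assume "g \<otimes> x \<in> P"
  moreover have "x = inv g \<otimes> (g \<otimes> x)"
    using assms by (simp add: m_assoc [symmetric])
  ultimately show "x \<in> inv g <# P"
    by (auto simp: l_coset_def)
qed

text \<open>A reversed suffix has the inverse value, so each coset in the intersection says that one
  suffix of even length carries \<open>x\<close> into \<open>P\<close>.\<close>

lemma K_ideal_iff:
  assumes "\<alpha> \<in> words P"
  shows "x \<in> K_ideal G P \<alpha> \<longleftrightarrow>
    x \<in> P \<and> (\<forall>i<length \<alpha> div 2. word_val G (drop (2 * i) \<alpha>) \<otimes> x \<in> P)"
  using assms
  by (auto simp: K_ideal_def word_val_rev words_drop l_coset_inv_iff)

lemma K_ideal_Nil [simp]: "K_ideal G P [] = P"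
  by (simp add: K_ideal_def)

text \<open>Index 0 contributes the new condition; the other suffixes are those of \<alpha>.\<close>

lemma K_ideal_Cons2:
  assumes "p \<in> P" "q \<in> P" "\<alpha> \<in> words P"
  shows "x \<in> K_ideal G P (p # q # \<alpha>) \<longleftrightarrow>
    x \<in> K_ideal G P \<alpha> \<and> inv p \<otimes> (q \<otimes> (word_val G \<alpha> \<otimes> x)) \<in> P"
  using assms
  by (cases "x \<in> P") (auto simp: K_ideal_iff All_less_Suc2 m_assoc)

lemma K_ideal_subset: "K_ideal G P \<alpha> \<subseteq> P"
  by (auto simp: K_ideal_def)

lemma K_ideal_in_carrier [simp]: "x \<in> K_ideal G P \<alpha> \<Longrightarrow> x \<in> carrier G"
  by (rule in_carrier) (rule subsetD [OF K_ideal_subset])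

lemma word_val_K_ideal:
  "\<alpha> \<in> words P \<Longrightarrow> x \<in> K_ideal G P \<alpha> \<Longrightarrow> word_val G \<alpha> \<otimes> x \<in> P"
  by (induction rule: words_induct) (auto simp: K_ideal_Cons2 m_assoc)

text \<open>This is the domain of a composite of partial maps; words act from their right end, so
  \<beta> comes first.\<close>

lemma K_ideal_append:
  assumes "\<alpha> \<in> words P" "\<beta> \<in> words P"
  shows "x \<in> K_ideal G P (\<alpha> @ \<beta>) \<longleftrightarrow>
    x \<in> K_ideal G P \<beta> \<and> word_val G \<beta> \<otimes> x \<in> K_ideal G P \<alpha>"
  using assms
proof (induction rule: words_induct)
  case Nil
  then show ?case by (auto simp: word_val_K_ideal)
next
  case (Cons p q \<alpha>)
  then show ?case
    by (cases "x \<in> K_ideal G P \<beta>")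
      (simp_all add: K_ideal_Cons2 words_append word_val_append m_assoc)
qed

text \<open>The reversed word retraces the path of \<open>x\<close> through the same points of
  \<open>P\<close> in the opposite order.\<close>

lemma word_val_K_ideal_rev:
  assumes "\<alpha> \<in> words P" "x \<in> K_ideal G P \<alpha>"
  shows "word_val G \<alpha> \<otimes> x \<in> K_ideal G P (rev \<alpha>)"
  using assms
proof (induction rule: words_induct)
  case Nil
  then show ?case by simp
next
  case (Cons p q \<alpha>)
  let ?z = "word_val G \<alpha> \<otimes> x"
  let ?y = "inv p \<otimes> (q \<otimes> ?z)"
  have x: "x \<in> K_ideal G P \<alpha>" and y: "?y \<in> P"
    using Cons by (auto simp: K_ideal_Cons2)
  have z: "?z \<in> P" and zr: "?z \<in> K_ideal G P (rev \<alpha>)"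
    using Cons x by (auto simp: word_val_K_ideal)
  \<comment> \<open>The reversed pair \<open>[q, p]\<close> sends \<open>?y\<close> back to
    \<open>?z\<close>, which by induction lies in the domain of \<open>rev \<alpha>\<close>.\<close>
  have "p \<otimes> ?y = q \<otimes> ?z"
    using Cons x by (simp add: m_assoc [symmetric])
  moreover have "inv q \<otimes> (q \<otimes> ?z) = ?z"
    using Cons x by (simp add: m_assoc [symmetric])
  ultimately have "inv q \<otimes> (p \<otimes> ?y) = ?z"
    by simp
  then have "?y \<in> K_ideal G P (rev \<alpha> @ [q, p])"
    using Cons y z zr by (simp add: K_ideal_append K_ideal_Cons2 words_rev m_assoc)
  then show ?case
    using Cons x by (simp add: m_assoc)
qed

lemma K_ideal_rev_append: "\<alpha> \<in> words P \<Longrightarrow> K_ideal G P (rev \<alpha> @ \<alpha>) = K_ideal G P \<alpha>"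
  by (auto simp: K_ideal_append words_rev word_val_K_ideal_rev)

lemma neutral_rev_append: "\<alpha> \<in> words P \<Longrightarrow> neutral G (rev \<alpha> @ \<alpha>)"
  by (simp add: neutral_def word_val_append words_rev word_val_rev)

lemma neutral_rev: "\<alpha> \<in> words P \<Longrightarrow> neutral G \<alpha> \<Longrightarrow> neutral G (rev \<alpha>)"
  by (simp add: neutral_def word_val_rev)

lemma K_ideal_rev_neutral:
  assumes "\<alpha> \<in> words P" "neutral G \<alpha>"
  shows "K_ideal G P (rev \<alpha>) = K_ideal G P \<alpha>"
proof -
  \<comment> \<open>A neutral word fixes every point of its domain, so retracing yields this
    inclusion; its instance at \<open>rev \<alpha>\<close> is the converse one.\<close>
  have "K_ideal G P \<beta> \<subseteq> K_ideal G P (rev \<beta>)" if "\<beta> \<in> words P" "neutral G \<beta>" for \<beta>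
    using word_val_K_ideal_rev that by (fastforce simp: neutral_def)
  from this [of \<alpha>] this [of "rev \<alpha>"] show ?thesis
    using assms by (auto simp: words_rev neutral_rev)
qed

lemma neutral_append_self: "\<alpha> \<in> words P \<Longrightarrow> neutral G \<alpha> \<Longrightarrow> neutral G (\<alpha> @ \<alpha>)"
  by (simp add: neutral_def word_val_append)

lemma K_ideal_append_self:
  "\<alpha> \<in> words P \<Longrightarrow> neutral G \<alpha> \<Longrightarrow> K_ideal G P (\<alpha> @ \<alpha>) = K_ideal G P \<alpha>"
  by (auto simp: K_ideal_append neutral_def)

text \<open>Bridges a mismatch: ideals are presented by arbitrary words, but the relations constrain
  neutral ones only.\<close>

lemma constructible_neutral:
  assumes "S \<in> constructible_ideals G P"
  obtains \<alpha> where "\<alpha> \<in> words P" "neutral G \<alpha>" "K_ideal G P \<alpha> = S"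
proof -
  obtain \<alpha> where \<alpha>: "\<alpha> \<in> words P" "S = K_ideal G P \<alpha>"
    using assms by (auto simp: constructible_ideals_def)
  show thesis
    by (rule that [of "rev \<alpha> @ \<alpha>"])
      (use \<alpha> in \<open>simp_all add: words_append words_rev K_ideal_rev_append neutral_rev_append\<close>)
qed

text \<open>The letter \<open>\<one>\<close> is padding: once \<open>w \<one> = \<one>\<close>, the
  star word is the adjoint of \<open>w (p \<otimes> q)\<close> times \<open>w p\<close> times
  \<open>w q\<close>.\<close>

lemma K_ideal_mult_word:
  assumes "p \<in> P" "q \<in> P"
  shows "neutral G [p \<otimes> q, p, \<one>, q]" and "K_ideal G P [p \<otimes> q, p, \<one>, q] = P"
proof -
  have cancel: "inv (p \<otimes> q) \<otimes> (p \<otimes> (q \<otimes> x)) = x" if "x \<in> carrier G" for x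
    using assms that by (simp add: inv_mult_group m_assoc inv_solve_left')
  show "neutral G [p \<otimes> q, p, \<one>, q]"
    using assms cancel [of \<one>] by (simp add: neutral_def m_assoc)
  show "K_ideal G P [p \<otimes> q, p, \<one>, q] = P"
    using assms cancel by (auto simp: K_ideal_Cons2)
qed

lemma K_ideal_diagonal:
  assumes "p \<in> P"
  shows "neutral G [p, p]" and "K_ideal G P [p, p] = P"
  using assms by (auto simp: neutral_def K_ideal_Cons2 m_assoc [symmetric])

end

section \<open>Adjoints, isometries and star words in a C*-algebra\<close>

context unital_cstar_algebra
begin

lemma adj_one: "adj A \<one> = \<one>"
  by (metis adj_adj adj_closed adj_mult one_closed r_one)

lemma adj_zero: "adj A \<zero> = \<zero>"
  by (metis adj_add adj_closed add.r_cancel_one l_zero zero_closed)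

lemma adj_minus: "x \<in> carrier A \<Longrightarrow> adj A (\<ominus> x) = \<ominus> adj A x"
  by (metis a_inv_closed adj_add adj_closed adj_zero l_neg minus_equality)

lemma adj_mult_self_eq_zero:
  assumes "x \<in> carrier A" "adj A x \<otimes> x = \<zero>"
  shows "x = \<zero>"
  using assms cstar_identity [of x] norm_eq_zero [of x] norm_eq_zero [of \<zero>] by simp

lemma isometries_eqI:
  assumes x: "x \<in> carrier A" "adj A x \<otimes> x = \<one>"
    and y: "y \<in> carrier A" "adj A y \<otimes> y = \<one>"
    and yx: "adj A y \<otimes> x = \<one>"
  shows "x = y"
proof -
  \<comment> \<open>The second cross term is the adjoint of the given one.\<close>
  have "adj A x \<otimes> y = adj A (adj A y \<otimes> x)"
    using x y by (simp add: adj_mult adj_closed adj_adj)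
  then have xy: "adj A x \<otimes> y = \<one>"
    using yx adj_one by simp
  have "adj A (x \<ominus> y) \<otimes> (x \<ominus> y) = (adj A x \<ominus> adj A y) \<otimes> (x \<ominus> y)"
    using x y by (simp add: minus_eq adj_add adj_minus)
  \<comment> \<open>The expansion has the terms 1, -1, -1 and 1.\<close>
  also have "\<dots> = \<zero>"
    using x y xy yx
    by (simp add: minus_eq l_distr r_distr l_minus r_minus adj_closed r_neg l_neg)
  finally have "x \<ominus> y = \<zero>"
    using x y adj_mult_self_eq_zero by simp
  then show ?thesis
    using x y by (metis a_minus_def add.inv_closed minus_equality minus_minus)
qed

lemma star_word_closed:
  "\<alpha> \<in> words P \<Longrightarrow> \<forall>p\<in>P. w p \<in> carrier A \<Longrightarrow> star_word A w \<alpha> \<in> carrier A"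
  by (induction rule: words_induct) (auto simp: adj_closed)

lemma star_word_append:
  "\<alpha> \<in> words P \<Longrightarrow> \<beta> \<in> words P \<Longrightarrow> \<forall>p\<in>P. w p \<in> carrier A \<Longrightarrow>
    star_word A w (\<alpha> @ \<beta>) = star_word A w \<alpha> \<otimes> star_word A w \<beta>"
  by (induction rule: words_induct) (auto simp: adj_closed m_assoc star_word_closed)

text \<open>Reversal swaps the letters within each pair and the order of the pairs, just as the
  adjoint does to a product of factors \<open>adj A (w p) \<otimes> w q\<close>.\<close>

lemma star_word_rev:
  "\<alpha> \<in> words P \<Longrightarrow> \<forall>p\<in>P. w p \<in> carrier A \<Longrightarrow>
    star_word A w (rev \<alpha>) = adj A (star_word A w \<alpha>)"
  by (induction rule: words_induct)
    (auto simp: adj_one star_word_append [where P = P] words_rev adj_mult adj_closed adj_adj m_assoc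
      star_word_closed)

end

section \<open>Unital star-homomorphisms\<close>

lemma star_hom_closed: "star_hom A B \<phi> \<Longrightarrow> x \<in> carrier A \<Longrightarrow> \<phi> x \<in> carrier B"
  by (auto simp: star_hom_def ring_hom_closed)

lemma star_hom_zero:
  assumes "unital_cstar_algebra A" "unital_cstar_algebra B" "star_hom A B \<phi>"
  shows "\<phi> \<zero>\<^bsub>A\<^esub> = \<zero>\<^bsub>B\<^esub>"
  using assms ring_hom_zero
  by (auto simp: star_hom_def unital_cstar_algebra_def)

lemma star_hom_id: "star_hom A A (\<lambda>x. x)"
  by (auto simp: star_hom_def ring_hom_def)

lemma star_hom_comp:
  assumes "star_hom A B \<phi>" "star_hom B C \<psi>"
  shows "star_hom A C (\<lambda>x. \<psi> (\<phi> x))"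
  using assms by (auto simp: star_hom_def ring_hom_def Pi_iff)

lemma star_hom_star_word:
  assumes "unital_cstar_algebra A" "star_hom A B \<phi>" "\<forall>p\<in>P. w p \<in> carrier A"
    and "\<forall>p\<in>P. \<phi> (w p) = v p" "\<alpha> \<in> words P"
  shows "\<phi> (star_word A w \<alpha>) = star_word B v \<alpha>"
proof -
  interpret unital_cstar_algebra A by fact
  have hom: "\<phi> \<in> ring_hom A B" and adj: "\<And>x. x \<in> carrier A \<Longrightarrow> \<phi> (adj A x) = adj B (\<phi> x)"
    using assms by (auto simp: star_hom_def)
  show ?thesis
    using assms(5)
    by (induction rule: words_induct)
      (use assms(3,4) hom adj in
        \<open>auto simp: ring_hom_one ring_hom_mult adj_closed star_word_closed\<close>)
qed

text \<open>Recovers Li's projections from the elements \<open>w p\<close>. The empty set is treated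
  apart because it need not be constructible, in which case there is no word to choose.\<close>

definition sharp_projection ::
    "('g, 'm) monoid_scheme \<Rightarrow> 'g set \<Rightarrow> ('a, 'n) cstar_scheme \<Rightarrow> ('g \<Rightarrow> 'a) \<Rightarrow> 'g set \<Rightarrow> 'a"
  where "sharp_projection G P A w S = (if S = {} then \<zero>\<^bsub>A\<^esub>
    else star_word A w (SOME \<alpha>. \<alpha> \<in> words P \<and> neutral G \<alpha> \<and> K_ideal G P \<alpha> = S))"

text \<open>(T3) makes the chosen word irrelevant, and (T2) agrees with the value fixed at the empty
  set.\<close>

lemma sharp_projection_K_ideal:
  assumes "sharp_family G P A w" "\<alpha> \<in> words P" "neutral G \<alpha>"
  shows "sharp_projection G P A w (K_ideal G P \<alpha>) = star_word A w \<alpha>"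
proof (cases "K_ideal G P \<alpha> = {}")
  case True
  then show ?thesis
    using assms by (simp add: sharp_projection_def sharp_family_def)
next
  case False
  let ?Q = "\<lambda>\<beta>. \<beta> \<in> words P \<and> neutral G \<beta> \<and> K_ideal G P \<beta> = K_ideal G P \<alpha>"
  have "?Q (Eps ?Q)"
    by (rule someI [of ?Q \<alpha>]) (use assms in simp)
  then have "star_word A w (Eps ?Q) = star_word A w \<alpha>"
    using assms unfolding sharp_family_def by blast
  with False show ?thesis
    by (simp add: sharp_projection_def)
qed

section \<open>Equivalence of the two sets of relations\<close>

context group_submonoid
begin

lemma sharp_family_imp_Li_family:
  assumes "unital_cstar_algebra A" and sharp: "sharp_family G P A w"
  shows "Li_family G P A w (sharp_projection G P A w)"
proof -
  interpret A: unital_cstar_algebra A by fact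
  have w: "\<forall>p\<in>P. w p \<in> carrier A" and w1: "w \<one> = \<one>\<^bsub>A\<^esub>"
    and T3: "\<And>\<alpha> \<beta>. \<lbrakk>\<alpha> \<in> words P; \<beta> \<in> words P; neutral G \<alpha>; neutral G \<beta>;
      K_ideal G P \<alpha> = K_ideal G P \<beta>\<rbrakk> \<Longrightarrow> star_word A w \<alpha> = star_word A w \<beta>"
    using sharp unfolding sharp_family_def by blast+
  \<comment> \<open>(T3) against the empty word, which has domain \<open>P\<close> and value
    1.\<close>
  have full: "star_word A w \<alpha> = \<one>\<^bsub>A\<^esub>"
    if "\<alpha> \<in> words P" "neutral G \<alpha>" "K_ideal G P \<alpha> = P" for \<alpha>
    using T3 [of \<alpha> "[]"] that by (simp add: neutral_def)
  have iso: "adj A (w p) \<otimes>\<^bsub>A\<^esub> w p = \<one>\<^bsub>A\<^esub>" if "p \<in> P" for p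
    using full [of "[p, p]"] K_ideal_diagonal [OF that] that w by (simp add: A.adj_closed)
  have mult: "w p \<otimes>\<^bsub>A\<^esub> w q = w (p \<otimes> q)" if pq: "p \<in> P" "q \<in> P" for p q
  proof (rule A.isometries_eqI)
    have [simp]: "w p \<in> carrier A" "w q \<in> carrier A" "w (p \<otimes> q) \<in> carrier A"
      using w pq by auto
    show "w p \<otimes>\<^bsub>A\<^esub> w q \<in> carrier A" "w (p \<otimes> q) \<in> carrier A"
      by simp_all
    show "adj A (w (p \<otimes> q)) \<otimes>\<^bsub>A\<^esub> w (p \<otimes> q) = \<one>\<^bsub>A\<^esub>"
      using pq iso by simp
    show "adj A (w (p \<otimes> q)) \<otimes>\<^bsub>A\<^esub> (w p \<otimes>\<^bsub>A\<^esub> w q) = \<one>\<^bsub>A\<^esub>"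
      using full [of "[p \<otimes> q, p, \<one>, q]"] K_ideal_mult_word [OF pq] pq w1
      by (simp add: A.adj_closed A.adj_one A.m_assoc)
    have "adj A (w q) \<otimes>\<^bsub>A\<^esub> (adj A (w p) \<otimes>\<^bsub>A\<^esub> w p) \<otimes>\<^bsub>A\<^esub> w q = \<one>\<^bsub>A\<^esub>"
      using pq iso by (simp add: A.adj_closed)
    then show "adj A (w p \<otimes>\<^bsub>A\<^esub> w q) \<otimes>\<^bsub>A\<^esub> (w p \<otimes>\<^bsub>A\<^esub> w q) = \<one>\<^bsub>A\<^esub>"
      by (simp add: A.adj_mult A.adj_closed A.m_assoc)
  qed
  have proj: "f \<in> carrier A \<and> adj A f = f \<and> f \<otimes>\<^bsub>A\<^esub> f = f"
    if S: "S \<in> constructible_ideals G P" and f: "f = sharp_projection G P A w S" for S f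
  proof -
    obtain \<alpha> where \<alpha>: "\<alpha> \<in> words P" "neutral G \<alpha>" "K_ideal G P \<alpha> = S"
      using S by (rule constructible_neutral)
    then have f: "f = star_word A w \<alpha>"
      using f sharp_projection_K_ideal [OF sharp] by blast
    \<comment> \<open>Reversing a neutral word keeps its ideal and takes the adjoint of its value;
      below, doubling the word keeps the ideal and squares the value.\<close>
    have "adj A f = f"
      using T3 [of "rev \<alpha>" \<alpha>] \<alpha> f w
      by (simp add: A.star_word_rev words_rev neutral_rev K_ideal_rev_neutral)
    moreover have "f \<otimes>\<^bsub>A\<^esub> f = f"
      using T3 [of "\<alpha> @ \<alpha>" \<alpha>] \<alpha> f w
      by (simp add: A.star_word_append words_append neutral_append_self K_ideal_append_self)
    ultimately show ?thesis
      using \<alpha> f w A.star_word_closed by simp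
  qed
  have zero: "sharp_projection G P A w {} = \<zero>\<^bsub>A\<^esub>"
    by (simp add: sharp_projection_def)
  show ?thesis
    unfolding Li_family_def
    using w iso mult proj zero sharp_projection_K_ideal [OF sharp] by (auto simp: A.adj_zero)
qed

lemma Li_family_imp_sharp_family:
  assumes "unital_cstar_algebra A" and Li: "Li_family G P A v e"
  shows "sharp_family G P A v"
proof -
  interpret A: unital_cstar_algebra A by fact
  have v: "\<And>p. p \<in> P \<Longrightarrow> v p \<in> carrier A"
    and iso: "\<And>p. p \<in> P \<Longrightarrow> adj A (v p) \<otimes>\<^bsub>A\<^esub> v p = \<one>\<^bsub>A\<^esub>"
    and mult: "\<And>p q. p \<in> P \<Longrightarrow> q \<in> P \<Longrightarrow> v p \<otimes>\<^bsub>A\<^esub> v q = v (p \<otimes> q)"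
    and e0: "e {} = \<zero>\<^bsub>A\<^esub>"
    and eK: "\<And>\<alpha>. \<alpha> \<in> words P \<Longrightarrow> neutral G \<alpha> \<Longrightarrow> star_word A v \<alpha> = e (K_ideal G P \<alpha>)"
    using Li by (auto simp: Li_family_def constructible_ideals_def)
  \<comment> \<open>(T2) and (T3) follow since neutral words take values
    \<open>e (K_ideal G P \<alpha>)\<close>. For (T1), \<open>v \<one>\<close> is an idempotent
    isometry, so cancelling one factor leaves 1.\<close>
  have "v \<one> = adj A (v \<one>) \<otimes>\<^bsub>A\<^esub> v \<one> \<otimes>\<^bsub>A\<^esub> v \<one>"
    using iso v by simp
  also have "\<dots> = adj A (v \<one>) \<otimes>\<^bsub>A\<^esub> (v \<one> \<otimes>\<^bsub>A\<^esub> v \<one>)"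
    using v by (simp add: A.m_assoc A.adj_closed)
  also have "\<dots> = \<one>\<^bsub>A\<^esub>"
    using mult iso by simp
  finally have "v \<one> = \<one>\<^bsub>A\<^esub>" .
  then show ?thesis
    unfolding sharp_family_def using v eK e0 by auto
qed

end

section \<open>Mutually inverse homomorphisms from the universal properties\<close>

theorem proposition3p22:
  fixes G :: "('g, 'm) monoid_scheme" and P :: "'g set"
    and A :: "'a cstar" and w :: "'g \<Rightarrow> 'a"
    and B :: "'b cstar" and v :: "'g \<Rightarrow> 'b" and e :: "'g set \<Rightarrow> 'b"
  assumes "group G" and "submonoid P G"
    and "universal_sharp G P A w TYPE('a)" and "universal_sharp G P A w TYPE('b)"
    and "universal_Li G P B v e TYPE('a)" and "universal_Li G P B v e TYPE('b)"
  shows "\<exists>\<phi>. star_iso A B \<phi> \<and> (\<forall>p\<in>P. \<phi> (w p) = v p)"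
proof -
  interpret group_submonoid G P
    using assms(1,2) by (simp add: group_submonoid_def)
  let ?J = "constructible_ideals G P \<union> {{}}"
  let ?f = "sharp_projection G P A w"
  have A: "unital_cstar_algebra A" and w: "sharp_family G P A w"
    using assms(3) by (auto simp: universal_sharp_def)
  have B: "unital_cstar_algebra B" and v: "Li_family G P B v e"
    using assms(5) by (auto simp: universal_Li_def)
  have w_closed: "\<forall>p\<in>P. w p \<in> carrier A"
    using w by (simp add: sharp_family_def)
  have f: "Li_family G P A w ?f"
    using A w by (rule sharp_family_imp_Li_family)
  have v': "sharp_family G P B v"
    using B v by (rule Li_family_imp_sharp_family)
  \<comment> \<open>Here and below, each use of universality takes the hypothesis whose test type is
    the element type of the target algebra.\<close>
  obtain \<phi> where \<phi>: "star_hom A B \<phi>" "\<forall>p\<in>P. \<phi> (w p) = v p"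
    using assms(4) B v' unfolding universal_sharp_def by blast
  obtain \<psi> where \<psi>: "star_hom B A \<psi>" "\<forall>p\<in>P. \<psi> (v p) = w p" "\<forall>S\<in>?J. \<psi> (e S) = ?f S"
    using assms(5) A f unfolding universal_Li_def by blast
  \<comment> \<open>By uniqueness, both the identity and \<psi> after \<phi> coincide with \<theta>
    on \<open>A\<close>.\<close>
  obtain \<theta> where \<theta>: "\<And>\<chi>. star_hom A A \<chi> \<Longrightarrow> \<forall>p\<in>P. \<chi> (w p) = w p \<Longrightarrow>
      \<forall>x\<in>carrier A. \<chi> x = \<theta> x"
    using assms(3) A w unfolding universal_sharp_def by blast
  have \<psi>\<phi>: "\<psi> (\<phi> x) = x" if "x \<in> carrier A" for x
    using \<theta> [OF star_hom_comp [OF \<phi>(1) \<psi>(1)]] \<theta> [OF star_hom_id] \<phi>(2) \<psi>(2) that by simp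
  have "\<exists>\<eta>. star_hom B B \<eta> \<and> (\<forall>p\<in>P. \<eta> (v p) = v p) \<and> (\<forall>S\<in>?J. \<eta> (e S) = e S) \<and>
      (\<forall>\<chi>. star_hom B B \<chi> \<and> (\<forall>p\<in>P. \<chi> (v p) = v p) \<and> (\<forall>S\<in>?J. \<chi> (e S) = e S) \<longrightarrow>
        (\<forall>x\<in>carrier B. \<chi> x = \<eta> x))"
    using assms(6) [unfolded universal_Li_def] B v by simp
  then obtain \<eta> where \<eta>: "\<forall>\<chi>. star_hom B B \<chi> \<and> (\<forall>p\<in>P. \<chi> (v p) = v p) \<and>
      (\<forall>S\<in>?J. \<chi> (e S) = e S) \<longrightarrow> (\<forall>x\<in>carrier B. \<chi> x = \<eta> x)"
    by (elim exE conjE)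
  \<comment> \<open>Uniqueness on \<open>B\<close> also demands that \<phi> after \<psi> fix every
    \<open>e S\<close>. As \<psi> maps \<open>e S\<close> to \<open>?f S\<close>, it remains to
    evaluate \<phi> there, through a neutral word for nonempty \<open>S\<close>.\<close>
  have "\<phi> (?f S) = e S" if "S \<in> ?J" for S
  proof (cases "S = {}")
    case True
    then show ?thesis
      using v star_hom_zero [OF A B \<phi>(1)] by (simp add: sharp_projection_def Li_family_def)
  next
    case False
    then obtain \<alpha> where \<alpha>: "\<alpha> \<in> words P" "neutral G \<alpha>" "K_ideal G P \<alpha> = S"
      using \<open>S \<in> ?J\<close> constructible_neutral by blast
    then have "\<phi> (?f S) = star_word B v \<alpha>"
      using sharp_projection_K_ideal [OF w] star_hom_star_word [OF A \<phi>(1) w_closed \<phi>(2)] by metis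
    also have "\<dots> = e S"
      using v \<alpha> by (auto simp: Li_family_def constructible_ideals_def)
    finally show ?thesis .
  qed
  then have \<phi>\<psi>: "\<phi> (\<psi> y) = y" if "y \<in> carrier B" for y
    using \<eta> [rule_format, of "\<lambda>x. \<phi> (\<psi> x)"] \<eta> [rule_format, of "\<lambda>x. x"]
      star_hom_comp [OF \<psi>(1) \<phi>(1)] star_hom_id [of B] \<phi>(2) \<psi>(2,3) that by simp
  have "bij_betw \<phi> (carrier A) (carrier B)"
    by (rule bij_betw_byWitness [where f' = \<psi>])
      (use \<psi>\<phi> \<phi>\<psi> star_hom_closed [OF \<phi>(1)] star_hom_closed [OF \<psi>(1)] in auto)
  then show ?thesis
    using \<phi> by (auto simp: star_iso_def)
qed

end
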